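(* Let $\Omega$ be a domain in a Carnot group $\mathbb{G}$ and let $(Y,d)$ be a metric space. If a mapping $\varphi:\Omega\to Y$ induces the bounded composition operator $$\varphi^*:\mathrm{Lip}(Y)\to L^1_\infty(\Omega),\qquad\varphi^*u=u\circ\varphi,$$ then $\varphi\in L^1_\infty(\Omega;Y)$ and $\big\|\,|\nabla_0\varphi|\mid L_\infty(\Omega)\big\|=\|\varphi^*\|$.
   Context: Carnot group: a connected simply-connected Lie group $\mathbb{G}$ whose Lie algebra $\mathfrak g$ of left-invariant vector fields decomposes as $\mathfrak g=\mathfrak g_1\oplus\dots\oplus\mathfrak g_m$ with $[\mathfrak g_1,\mathfrak g_i]=\mathfrak g_{i+1}$ for $1\le i\le m-1$ and $[\mathfrak g_1,\mathfrak g_m]=\{0\}$. An inner product on $\mathfrak g$ is fixed, and $X_1,\dots,X_n$ is an orthonormal basis of the horizontal space $\mathfrak g_1$. Via the exponential map $\mathbb G$ is identified with $\mathbb R^N$, $N=\dim\mathfrak g$; $dx$ is (suitably normalized) Lebesgue measure, a bi-invariant Haar measure. A domain is a nonempty connected open set. $L^1_\infty(\Omega)$: the functions $u\in L_{1,\mathrm{loc}}(\Omega)$ having generalized (weak) derivatives $X_ju\in L_\infty(\Omega)$, $j=1,\dots,n$, meaning $\int_\Omega (X_ju)v\,dx=-\int_\Omega uX_jv\,dx$ for all $v\in C_0^\infty(\Omega)$. Put $\nabla_hu=(X_1u,\dots,X_nu)$, with Euclidean norm $|\nabla_hu|$; the seminorm is $\|u\mid L^1_\infty(\Omega)\|=\||\nabla_hu|\mid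 L_\infty(\Omega)\|$ (essential supremum). $\mathrm{Lip}(Y)$: all Lipschitz functions $u:Y\to\mathbb R$, with seminorm $\mathrm{Lip}(u)=\sup_{y_1\ne y_2}|u(y_1)-u(y_2)|/d(y_1,y_2)$. The mapping $\varphi$ induces the bounded composition operator if $u\circ\varphi\in L^1_\infty(\Omega)$ for all $u\in\mathrm{Lip}(Y)$ and there is a constant $C$ with $\|u\circ\varphi\mid L^1_\infty(\Omega)\|\le C\,\mathrm{Lip}(u)$ for all $u$; $\|\varphi^*\|$ is the least such $C\geq 0$. Reshetnyak class $L^1_\infty(\Omega;Y)$: measurable mappings $\varphi:\Omega\to Y$ (preimages of Borel sets are Lebesgue measurable) such that (1) $u\circ\varphi\in L^1_\infty(\Omega)$ for all $u\in\mathrm{Lip}(Y)$; (2) there is $g\in L_\infty(\Omega)$ with $|\nabla_h(u\circ\varphi)|\le\mathrm{Lip}(u)\,g$ a.e. in $\Omega$ for every $u\in\mathrm{Lip}(Y)$. For such $\varphi$, $|\nabla_0\varphi|$ denotes the a.e.-minimal function $g$ satisfying (2) (it is known to exist). *)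

theory Defs
  imports "HOL-Analysis.Analysis" "HOL-Probability.Essential_Supremum"
begin

section \<open>Smooth functions\<close>

text \<open>\<open>f\<close> is of class \<open>C\<^sup>k\<close> on the whole (finite-dimensional) space.\<close>

fun Ck :: "nat \<Rightarrow> ('a::euclidean_space \<Rightarrow> 'b::real_normed_vector) \<Rightarrow> bool" where
  "Ck 0 f \<longleftrightarrow> continuous_on UNIV f"
| "Ck (Suc k) f \<longleftrightarrow> (\<forall>x. f differentiable (at x)) \<and>
     (\<forall>v. Ck k (\<lambda>x. frechet_derivative f (at x) v))"

definition smooth :: "('a::euclidean_space \<Rightarrow> 'b::real_normed_vector) \<Rightarrow> bool" where
  "smooth f \<longleftrightarrow> (\<forall>k. Ck k f)"

section \<open>Carnot groups in exponential coordinates\<close>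

text \<open>The group is identified with its Lie algebra, a Euclidean space \<open>'a\<close>, via the exponential
  map; the inner product of \<open>'a\<close> is the inner product fixed on the Lie algebra, and Lebesgue
  measure on \<open>'a\<close> is the Haar measure. A left-invariant vector field is identified with its
  value at the identity \<open>0\<close>.\<close>

definition left_inv_field :: "('a::euclidean_space \<Rightarrow> 'a \<Rightarrow> 'a) \<Rightarrow> 'a \<Rightarrow> 'a \<Rightarrow> 'a" where
  "left_inv_field gmul v x = frechet_derivative (gmul x) (at 0) v"

text \<open>The sign is such that, as derivations, \<open>[X, Y] = X Y - Y X\<close>.\<close>

definition vf_bracket :: "('a::euclidean_space \<Rightarrow> 'a) \<Rightarrow> ('a \<Rightarrow> 'a) \<Rightarrow> 'a \<Rightarrow> 'a" where
  "vf_bracket X Y x = frechet_derivative Y (at x) (X x) - frechet_derivative X (at x) (Y x)"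

definition lie_bracket :: "('a::euclidean_space \<Rightarrow> 'a \<Rightarrow> 'a) \<Rightarrow> 'a \<Rightarrow> 'a \<Rightarrow> 'a" where
  "lie_bracket gmul u v = vf_bracket (left_inv_field gmul u) (left_inv_field gmul v) 0"

definition lie_bracket_span ::
    "('a::euclidean_space \<Rightarrow> 'a \<Rightarrow> 'a) \<Rightarrow> 'a set \<Rightarrow> 'a set \<Rightarrow> 'a set" where
  "lie_bracket_span gmul A B = span {lie_bracket gmul u v |u v. u \<in> A \<and> v \<in> B}"

text \<open>The assumption \<open>exp_coordinates\<close> says that \<open>t \<mapsto> t *\<^sub>R x\<close> is the one-parameter subgroup
  with initial velocity \<open>x\<close>, that is, that the exponential map is the identity of \<open>'a\<close>.\<close>

locale carnot_group =
  fixes gmul :: "'a::euclidean_space \<Rightarrow> 'a \<Rightarrow> 'a"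
    and V :: "nat \<Rightarrow> 'a set"
    and m :: nat
  assumes group_law: "Groups.group gmul 0 uminus"
    and smooth_gmul: "smooth (\<lambda>p. gmul (fst p) (snd p))"
    and exp_coordinates: "gmul (s *\<^sub>R x) (t *\<^sub>R x) = (s + t) *\<^sub>R x"
    and subspace_layer: "i \<in> {1..m} \<Longrightarrow> subspace (V i)"
    and direct_sum: "\<exists>!f. f \<in> (\<Pi>\<^sub>E i\<in>{1..m}. V i) \<and> x = (\<Sum>i\<in>{1..m}. f i)"
    and bracket_layer: "i \<in> {1..<m} \<Longrightarrow> lie_bracket_span gmul (V 1) (V i) = V (Suc i)"
    and bracket_last: "lie_bracket_span gmul (V 1) (V m) = {0}"

definition orthonormal_basis_of :: "(nat \<Rightarrow> 'a::euclidean_space) \<Rightarrow> nat \<Rightarrow> 'a set \<Rightarrow> bool" where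
  "orthonormal_basis_of e n W \<longleftrightarrow>
     (\<forall>i\<in>{1..n}. \<forall>j\<in>{1..n}. e i \<bullet> e j = (if i = j then 1 else 0)) \<and> span (e ` {1..n}) = W"

section \<open>The space \<open>L\<^sup>1\<^sub>\<infinity>\<close>\<close>

text \<open>Functions on \<open>\<Omega>\<close> are total functions whose values outside \<open>\<Omega>\<close> are irrelevant.
  Below, \<open>X 1, \<dots>, X n\<close> are the horizontal vector fields.\<close>

definition test_functions :: "'a::euclidean_space set \<Rightarrow> ('a \<Rightarrow> real) set" where
  "test_functions \<Omega> =
     {v. smooth v \<and> compact (closure {x. v x \<noteq> 0}) \<and> closure {x. v x \<noteq> 0} \<subseteq> \<Omega>}"

definition L1_loc :: "'a::euclidean_space set \<Rightarrow> ('a \<Rightarrow> real) set" where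
  "L1_loc \<Omega> = {u. \<forall>K. compact K \<and> K \<subseteq> \<Omega> \<longrightarrow> set_integrable lebesgue K u}"

definition Linf_norm :: "'a::euclidean_space set \<Rightarrow> ('a \<Rightarrow> real) \<Rightarrow> ereal" where
  "Linf_norm \<Omega> g = esssup (lebesgue_on \<Omega>) (\<lambda>x. ereal \<bar>g x\<bar>)"

definition Linf :: "'a::euclidean_space set \<Rightarrow> ('a \<Rightarrow> real) set" where
  "Linf \<Omega> = {g \<in> borel_measurable (lebesgue_on \<Omega>). Linf_norm \<Omega> g < \<infinity>}"

definition is_weak_deriv ::
    "'a::euclidean_space set \<Rightarrow> ('a \<Rightarrow> 'a) \<Rightarrow> ('a \<Rightarrow> real) \<Rightarrow> ('a \<Rightarrow> real) \<Rightarrow> bool" where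
  "is_weak_deriv \<Omega> X u w \<longleftrightarrow> w \<in> L1_loc \<Omega> \<and>
     (\<forall>v\<in>test_functions \<Omega>.
        (LINT x:\<Omega>|lebesgue. w x * v x) =
        - (LINT x:\<Omega>|lebesgue. u x * frechet_derivative v (at x) (X x)))"

text \<open>A weak derivative, if it exists, is unique up to null sets of \<open>\<Omega>\<close>; we choose a representative.\<close>

definition weak_deriv ::
    "'a::euclidean_space set \<Rightarrow> ('a \<Rightarrow> 'a) \<Rightarrow> ('a \<Rightarrow> real) \<Rightarrow> 'a \<Rightarrow> real" where
  "weak_deriv \<Omega> X u = (SOME w. is_weak_deriv \<Omega> X u w)"

definition L1inf ::
    "'a::euclidean_space set \<Rightarrow> (nat \<Rightarrow> 'a \<Rightarrow> 'a) \<Rightarrow> nat \<Rightarrow> ('a \<Rightarrow> real) set" where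
  "L1inf \<Omega> X n = {u \<in> L1_loc \<Omega>. \<forall>j\<in>{1..n}. \<exists>w\<in>Linf \<Omega>. is_weak_deriv \<Omega> (X j) u w}"

definition hgrad_norm ::
    "'a::euclidean_space set \<Rightarrow> (nat \<Rightarrow> 'a \<Rightarrow> 'a) \<Rightarrow> nat \<Rightarrow> ('a \<Rightarrow> real) \<Rightarrow> 'a \<Rightarrow> real" where
  "hgrad_norm \<Omega> X n u x = sqrt (\<Sum>j\<in>{1..n}. (weak_deriv \<Omega> (X j) u x)\<^sup>2)"

definition L1inf_seminorm ::
    "'a::euclidean_space set \<Rightarrow> (nat \<Rightarrow> 'a \<Rightarrow> 'a) \<Rightarrow> nat \<Rightarrow> ('a \<Rightarrow> real) \<Rightarrow> ereal" where
  "L1inf_seminorm \<Omega> X n u = Linf_norm \<Omega> (hgrad_norm \<Omega> X n u)"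

section \<open>Lipschitz functions and the composition operator\<close>

definition Lip :: "('y::metric_space \<Rightarrow> real) set" where
  "Lip = {u. \<exists>L. L-lipschitz_on UNIV u}"

text \<open>Inserting \<open>0\<close> matters only for a one-point space, where the set of quotients is empty.\<close>

definition Lip_seminorm :: "('y::metric_space \<Rightarrow> real) \<Rightarrow> real" where
  "Lip_seminorm u = Sup (insert 0 {\<bar>u y\<^sub>1 - u y\<^sub>2\<bar> / dist y\<^sub>1 y\<^sub>2 |y\<^sub>1 y\<^sub>2. y\<^sub>1 \<noteq> y\<^sub>2})"

definition comp_op_bound ::
    "'a::euclidean_space set \<Rightarrow> (nat \<Rightarrow> 'a \<Rightarrow> 'a) \<Rightarrow> nat \<Rightarrow> ('a \<Rightarrow> 'y::metric_space) \<Rightarrow> real \<Rightarrow> bool"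
  where "comp_op_bound \<Omega> X n \<phi> C \<longleftrightarrow>
     (\<forall>u\<in>Lip. L1inf_seminorm \<Omega> X n (u \<circ> \<phi>) \<le> ereal (C * Lip_seminorm u))"

definition induces_bounded_comp_op ::
    "'a::euclidean_space set \<Rightarrow> (nat \<Rightarrow> 'a \<Rightarrow> 'a) \<Rightarrow> nat \<Rightarrow> ('a \<Rightarrow> 'y::metric_space) \<Rightarrow> bool" where
  "induces_bounded_comp_op \<Omega> X n \<phi> \<longleftrightarrow>
     (\<forall>u\<in>Lip. u \<circ> \<phi> \<in> L1inf \<Omega> X n) \<and> (\<exists>C. comp_op_bound \<Omega> X n \<phi> C)"

definition comp_op_norm ::
    "'a::euclidean_space set \<Rightarrow> (nat \<Rightarrow> 'a \<Rightarrow> 'a) \<Rightarrow> nat \<Rightarrow> ('a \<Rightarrow> 'y::metric_space) \<Rightarrow> real" where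
  "comp_op_norm \<Omega> X n \<phi> = (LEAST C. 0 \<le> C \<and> comp_op_bound \<Omega> X n \<phi> C)"

section \<open>The Reshetnyak class\<close>

text \<open>Nonnegativity of \<open>g\<close> is automatic almost everywhere unless \<open>'y\<close> is a one-point space, where all
  Lipschitz seminorms vanish and a minimal \<open>g\<close> would otherwise not exist.\<close>

definition hgrad_majorants ::
    "'a::euclidean_space set \<Rightarrow> (nat \<Rightarrow> 'a \<Rightarrow> 'a) \<Rightarrow> nat \<Rightarrow> ('a \<Rightarrow> 'y::metric_space) \<Rightarrow> ('a \<Rightarrow> real) set"
  where "hgrad_majorants \<Omega> X n \<phi> =
     {g \<in> Linf \<Omega>. (AE x in lebesgue_on \<Omega>. 0 \<le> g x) \<and>
        (\<forall>u\<in>Lip. AE x in lebesgue_on \<Omega>. hgrad_norm \<Omega> X n (u \<circ> \<phi>) x \<le> Lip_seminorm u * g x)}"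

definition L1inf_map ::
    "'a::euclidean_space set \<Rightarrow> (nat \<Rightarrow> 'a \<Rightarrow> 'a) \<Rightarrow> nat \<Rightarrow> ('a \<Rightarrow> 'y::metric_space) set" where
  "L1inf_map \<Omega> X n =
     {\<phi> \<in> measurable (lebesgue_on \<Omega>) borel.
        (\<forall>u\<in>Lip. u \<circ> \<phi> \<in> L1inf \<Omega> X n) \<and> hgrad_majorants \<Omega> X n \<phi> \<noteq> {}}"

text \<open>\<open>nabla0_norm \<Omega> X n \<phi>\<close> is a representative of the function \<open>|\<nabla>\<^sub>0 \<phi>|\<close>, which is
  determined up to null sets of \<open>\<Omega>\<close>.\<close>

definition nabla0_norm ::
    "'a::euclidean_space set \<Rightarrow> (nat \<Rightarrow> 'a \<Rightarrow> 'a) \<Rightarrow> nat \<Rightarrow> ('a \<Rightarrow> 'y::metric_space) \<Rightarrow> 'a \<Rightarrow> real" where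
  "nabla0_norm \<Omega> X n \<phi> =
     (SOME g. g \<in> hgrad_majorants \<Omega> X n \<phi> \<and>
        (\<forall>g'\<in>hgrad_majorants \<Omega> X n \<phi>. AE x in lebesgue_on \<Omega>. g x \<le> g' x))"

end

theory Submission
  imports Defs
begin

text \<open>Two facts about the set of majorants \<open>g\<close> in the definition of the Reshetnyak class carry the
  proof.

  The first (\<open>const_in_hgrad_majorants_iff\<close>) is that a nonnegative constant \<open>C\<close> is a majorant exactly
  when it bounds the composition operator: both assertions say that
  \<open>|\<nabla>\<^sub>h (u \<circ> \<phi>)| \<le> C Lip(u)\<close> almost everywhere, for every Lipschitz \<open>u\<close>. Hence bounded composition
  operators have majorants.

  The second (\<open>nabla0_norm_least\<close>) is that the set of majorants, if nonempty, has an almost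
  everywhere least element \<open>|\<nabla>\<^sub>0 \<phi>|\<close>. There may be uncountably many Lipschitz \<open>u\<close>, each with its own
  exceptional null set, so a pointwise supremum over \<open>u\<close> or infimum over majorants is useless. But
  majorants are closed under infima of sequences (\<open>hgrad_majorants_INF\<close>), and a sequence suffices to
  minimise a weighted integral; a minimiser is least (\<open>ex_AE_least\<close>).

  Together they give the equality of norms. For \<open>C \<ge> 0\<close>, the constant \<open>C\<close> bounds the operator if and
  only if it is a majorant, that is, if and only if \<open>|\<nabla>\<^sub>0 \<phi>| \<le> C\<close> almost everywhere, that is,
  if and only if the \<open>L\<^sub>\<infinity>\<close> norm of \<open>|\<nabla>\<^sub>0 \<phi>|\<close> is at most \<open>C\<close>. So this norm is the least bound.

  Finally, \<open>\<phi>\<close> is measurable since the distance to a nonempty closed set is a Lipschitz function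
  whose zero set is that closed set (\<open>measurable_if_Lip_comp_measurable\<close>).\<close>

section \<open>Measurability and essential bounds\<close>

text \<open>Integrability on compact subsets yields measurability on each of them, and an open set is a
  countable union of compact subsets.\<close>

lemma borel_measurable_if_L1_loc:
  fixes \<Omega> :: "'a::euclidean_space set"
  assumes "open \<Omega>" and u: "u \<in> L1_loc \<Omega>"
  shows "u \<in> borel_measurable (lebesgue_on \<Omega>)"
proof -
  obtain K :: "nat \<Rightarrow> 'a set" where K: "\<And>i. compact (K i)" "\<And>i. K i \<subseteq> \<Omega>" "(\<Union>i. K i) = \<Omega>"
    using open_Union_compact_subsets[OF \<open>open \<Omega>\<close>] by metis
  show ?thesis
  proof (rule measurable_piecewise_restrict[of "range K"])
    fix A assume "A \<in> range K"
    then have A: "compact A" "A \<subseteq> \<Omega>"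
      using K by auto
    then have [measurable]: "A \<in> sets lebesgue"
      using lmeasurable_compact by blast
    show "A \<inter> space (lebesgue_on \<Omega>) \<in> sets (lebesgue_on \<Omega>)"
      using A \<open>open \<Omega>\<close> by (auto simp: sets_restrict_space)
    have "set_integrable lebesgue A u"
      using u A by (auto simp: L1_loc_def)
    then have "u \<in> borel_measurable (lebesgue_on A)"
      by (subst borel_measurable_restrict_space_iff)
         (auto simp: set_integrable_def dest: borel_measurable_integrable)
    then show "u \<in> borel_measurable (restrict_space (lebesgue_on \<Omega>) A)"
      using A by (simp add: restrict_restrict_space \<open>open \<Omega>\<close> Int_absorb1)
  qed (use K in auto)
qed

lemma Linf_norm_le_iff:
  assumes [measurable]: "g \<in> borel_measurable (lebesgue_on \<Omega>)"
  shows "Linf_norm \<Omega> g \<le> ereal c \<longleftrightarrow> (AE x in lebesgue_on \<Omega>. \<bar>g x\<bar> \<le> c)"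
proof
  assume "Linf_norm \<Omega> g \<le> ereal c"
  moreover have "AE x in lebesgue_on \<Omega>. ereal \<bar>g x\<bar> \<le> Linf_norm \<Omega> g"
    unfolding Linf_norm_def by (rule esssup_AE)
  ultimately show "AE x in lebesgue_on \<Omega>. \<bar>g x\<bar> \<le> c"
    by (auto elim!: eventually_mono dest: order_trans)
next
  assume "AE x in lebesgue_on \<Omega>. \<bar>g x\<bar> \<le> c"
  then show "Linf_norm \<Omega> g \<le> ereal c"
    unfolding Linf_norm_def by (intro esssup_I) auto
qed

lemma Linf_iff:
  "g \<in> Linf \<Omega> \<longleftrightarrow> g \<in> borel_measurable (lebesgue_on \<Omega>) \<and> (\<exists>c. AE x in lebesgue_on \<Omega>. \<bar>g x\<bar> \<le> c)"
proof (cases "g \<in> borel_measurable (lebesgue_on \<Omega>)")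
  case True
  have "Linf_norm \<Omega> g < \<infinity> \<longleftrightarrow> (\<exists>c. Linf_norm \<Omega> g \<le> ereal c)"
    by (cases "Linf_norm \<Omega> g") auto
  then show ?thesis
    using True by (simp add: Linf_def Linf_norm_le_iff)
qed (simp add: Linf_def)

text \<open>On a null set the essential supremum of every function would be \<open>-\<infinity>\<close>; a nonempty open set is
  not null.\<close>

lemma Linf_norm_nonneg:
  fixes \<Omega> :: "'a::euclidean_space set"
  assumes "open \<Omega>" "\<Omega> \<noteq> {}"
  shows "0 \<le> Linf_norm \<Omega> g"
proof (rule ccontr)
  assume "\<not> 0 \<le> Linf_norm \<Omega> g"
  moreover have "AE x in lebesgue_on \<Omega>. ereal \<bar>g x\<bar> \<le> Linf_norm \<Omega> g"
    unfolding Linf_norm_def by (rule esssup_AE)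
  ultimately have "AE x in lebesgue_on \<Omega>. False"
    by (smt (verit) AE_cong abs_ge_zero ereal_less_eq(5) order_trans)
  then have "emeasure (lebesgue_on \<Omega>) \<Omega> = 0"
    by (subst (asm) AE_iff_measurable[OF _ refl]) auto
  then have "negligible \<Omega>"
    using assms by (simp add: emeasure_restrict_space negligible_iff_emeasure0)
  then show False
    using open_not_negligible assms by blast
qed

lemma borel_measurable_hgrad_norm:
  assumes "open \<Omega>" and "u \<in> L1inf \<Omega> X n"
  shows "hgrad_norm \<Omega> X n u \<in> borel_measurable (lebesgue_on \<Omega>)"
proof -
  have "weak_deriv \<Omega> (X j) u \<in> borel_measurable (lebesgue_on \<Omega>)" if "j \<in> {1..n}" for j
  proof (rule borel_measurable_if_L1_loc[OF \<open>open \<Omega>\<close>])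
    obtain w where "is_weak_deriv \<Omega> (X j) u w"
      using assms \<open>j \<in> {1..n}\<close> unfolding L1inf_def by blast
    then have "is_weak_deriv \<Omega> (X j) u (weak_deriv \<Omega> (X j) u)"
      unfolding weak_deriv_def by (rule someI[where P = "is_weak_deriv \<Omega> (X j) u"])
    then show "weak_deriv \<Omega> (X j) u \<in> L1_loc \<Omega>"
      by (simp add: is_weak_deriv_def)
  qed
  then show ?thesis
    unfolding hgrad_norm_def by measurable
qed

section \<open>Composition with Lipschitz functions\<close>

text \<open>For a Lipschitz function the difference quotients are bounded, so the supremum is a genuine one
  and dominates the inserted \<open>0\<close>.\<close>

lemma Lip_seminorm_nonneg:
  assumes "u \<in> Lip"
  shows "0 \<le> Lip_seminorm u"
proof -
  obtain L where L: "L-lipschitz_on UNIV u"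
    using assms by (auto simp: Lip_def)
  have "\<bar>u y\<^sub>1 - u y\<^sub>2\<bar> / dist y\<^sub>1 y\<^sub>2 \<le> L" if "y\<^sub>1 \<noteq> y\<^sub>2" for y\<^sub>1 y\<^sub>2
    using lipschitz_onD[OF L, of y\<^sub>1 y\<^sub>2] that by (simp add: divide_le_eq dist_real_def)
  then have "bdd_above (insert 0 {\<bar>u y\<^sub>1 - u y\<^sub>2\<bar> / dist y\<^sub>1 y\<^sub>2 |y\<^sub>1 y\<^sub>2. y\<^sub>1 \<noteq> y\<^sub>2})"
    using lipschitz_on_nonneg[OF L] by (auto simp: bdd_above_def intro!: exI[of _ L])
  then show ?thesis
    unfolding Lip_seminorm_def by (intro cSup_upper) auto
qed

text \<open>An open set \<open>S \<noteq> UNIV\<close> is the set where the 1-Lipschitz function ``distance to the complement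
  of \<open>S\<close>'' does not vanish, so that its preimage is seen by a single composition.\<close>

lemma measurable_if_Lip_comp_measurable:
  fixes \<phi> :: "'a \<Rightarrow> 'y::metric_space"
  assumes "\<And>u. u \<in> Lip \<Longrightarrow> u \<circ> \<phi> \<in> borel_measurable M"
  shows "\<phi> \<in> borel_measurable M"
proof (rule borel_measurableI)
  fix S :: "'y set" assume "open S"
  show "\<phi> -` S \<inter> space M \<in> sets M"
  proof (cases "S = UNIV")
    case False
    define u where "u y = infdist y (- S)" for y
    have "1-lipschitz_on UNIV u"
      unfolding u_def by (intro lipschitz_onI) (auto simp: dist_real_def infdist_triangle_abs)
    then have [measurable]: "u \<circ> \<phi> \<in> borel_measurable M"
      using assms by (auto simp: Lip_def)
    have "y \<in> - S \<longleftrightarrow> u y = 0" for y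
      unfolding u_def using False \<open>open S\<close> by (intro in_closed_iff_infdist_zero) auto
    then have "\<phi> -` S \<inter> space M = {x \<in> space M. (u \<circ> \<phi>) x \<noteq> 0}"
      by auto
    also have "\<dots> \<in> sets M"
      by measurable
    finally show ?thesis .
  qed auto
qed

section \<open>Almost everywhere least elements\<close>

text \<open>Integrate against a strictly positive integrable weight \<open>h\<close>. The infimum \<open>g\<close> of a minimising
  sequence lies in \<open>G\<close> and minimises the integral. If \<open>g \<le> g'\<close> failed on a set of positive measure
  for some \<open>g' \<in> G\<close>, then \<open>min g g'\<close>, again in \<open>G\<close>, would have a strictly smaller integral. The
  bounds from above keep the integrals finite, which the strict inequality requires.\<close>

lemma (in sigma_finite_measure) ex_AE_least:
  fixes G :: "('a \<Rightarrow> real) set"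
  assumes "G \<noteq> {}"
    and meas: "\<And>g. g \<in> G \<Longrightarrow> g \<in> borel_measurable M"
    and nonneg: "\<And>g. g \<in> G \<Longrightarrow> AE x in M. 0 \<le> g x"
    and bounded: "\<And>g. g \<in> G \<Longrightarrow> \<exists>c. AE x in M. g x \<le> c"
    and INF_closed: "\<And>f :: nat \<Rightarrow> 'a \<Rightarrow> real. range f \<subseteq> G \<Longrightarrow> (\<lambda>x. INF i. f i x) \<in> G"
  shows "\<exists>g\<in>G. \<forall>g'\<in>G. AE x in M. g x \<le> g' x"
proof -
  obtain h where h[measurable]: "h \<in> borel_measurable M"
    and h_fin: "integral\<^sup>N M h \<noteq> \<infinity>" and h_pos: "\<And>x. x \<in> space M \<Longrightarrow> 0 < h x \<and> h x < \<infinity>"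
    using Ex_finite_integrable_function by auto
  define J where "J g = (\<integral>\<^sup>+x. ennreal (g x) * h x \<partial>M)" for g
  obtain F :: "nat \<Rightarrow> ennreal" where F: "range F \<subseteq> J ` G" "Inf (J ` G) = (INF i. F i)"
    using ennreal_Inf_countable_INF[of "J ` G"] \<open>G \<noteq> {}\<close> by blast
  have "\<exists>g\<in>G. F i = J g" for i :: nat
    using F(1) by (auto simp: image_subset_iff)
  then obtain f where f: "\<And>i. f i \<in> G" "\<And>i. F i = J (f i)"
    by metis
  define g where "g x = (INF i. f i x)" for x
  have "g \<in> G"
    unfolding g_def using f by (intro INF_closed) auto
  have "AE x in M. \<forall>i. 0 \<le> f i x"
    using nonneg f by (simp add: AE_all_countable)
  then have g_le: "AE x in M. g x \<le> f i x" for i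
    by eventually_elim (auto simp: g_def intro!: cINF_lower bdd_belowI2)
  have "J g \<le> J (f i)" for i
    unfolding J_def using g_le[of i]
    by (intro nn_integral_mono_AE) (auto elim!: eventually_mono intro!: mult_right_mono ennreal_leI)
  then have J_min: "J g \<le> J g'" if "g' \<in> G" for g'
    using F f that by (metis INF_greatest INF_lower order_trans)
  obtain c where "AE x in M. g x \<le> c"
    using bounded \<open>g \<in> G\<close> by blast
  then have "J g \<le> (\<integral>\<^sup>+x. ennreal c * h x \<partial>M)"
    unfolding J_def
    by (intro nn_integral_mono_AE) (auto elim!: eventually_mono intro!: mult_right_mono ennreal_leI)
  also have "\<dots> < \<infinity>"
    using h_fin by (simp add: nn_integral_cmult ennreal_mult_less_top less_top)
  finally have J_fin: "J g < \<infinity>" .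
  have "AE x in M. g x \<le> g' x" if "g' \<in> G" for g'
  proof (rule ccontr)
    assume contr: "\<not> (AE x in M. g x \<le> g' x)"
    \<comment> \<open>The sequence \<open>g, g', g', \<dots>\<close> turns closure under infima of sequences into closure under \<open>min\<close>.\<close>
    have "(\<lambda>x. INF i. (if i = (0::nat) then g else g') x) \<in> G"
      using \<open>g \<in> G\<close> \<open>g' \<in> G\<close> by (intro INF_closed) auto
    moreover have "(INF i. (if i = (0::nat) then g else g') x) = min (g x) (g' x)" for x
    proof -
      have "range (\<lambda>i. (if i = (0::nat) then g else g') x) = {g x, g' x}"
        by (auto simp: image_iff intro: exI[of _ 1])
      then show ?thesis
        by (simp add: cInf_eq_Min)
    qed
    ultimately have min_G: "(\<lambda>x. min (g x) (g' x)) \<in> G"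
      by simp
    have "J (\<lambda>x. min (g x) (g' x)) < J g"
      unfolding J_def
    proof (rule nn_integral_less)
      note [measurable] = meas[OF \<open>g \<in> G\<close>] meas[OF \<open>g' \<in> G\<close>]
      show "(\<lambda>x. ennreal (g x) * h x) \<in> borel_measurable M"
        "(\<lambda>x. ennreal (min (g x) (g' x)) * h x) \<in> borel_measurable M"
        by measurable
      show "(\<integral>\<^sup>+x. ennreal (min (g x) (g' x)) * h x \<partial>M) \<noteq> \<infinity>"
      proof -
        have "J (\<lambda>x. min (g x) (g' x)) \<le> J g"
          unfolding J_def by (intro nn_integral_mono mult_right_mono ennreal_leI) auto
        also note J_fin
        finally show ?thesis
          by (simp add: J_def)
      qed
      show "AE x in M. ennreal (min (g x) (g' x)) * h x \<le> ennreal (g x) * h x"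
        by (auto intro!: mult_right_mono ennreal_leI)
      show "\<not> (AE x in M. ennreal (g x) * h x \<le> ennreal (min (g x) (g' x)) * h x)"
      proof
        assume "AE x in M. ennreal (g x) * h x \<le> ennreal (min (g x) (g' x)) * h x"
        with nonneg[OF min_G] AE_space have "AE x in M. g x \<le> g' x"
        proof eventually_elim
          case (elim x)
          then have "h x * ennreal (g x) \<le> h x * ennreal (min (g x) (g' x))"
            by (simp add: mult.commute)
          then have "ennreal (g x) \<le> ennreal (min (g x) (g' x))"
            using h_pos[of x] elim by (subst (asm) ennreal_mult_le_mult_iff) auto
          then show ?case
            using elim by (auto simp: ennreal_le_iff)
        qed
        with contr show False ..
      qed
    qed
    with J_min[OF min_G] show False
      by simp
  qed
  with \<open>g \<in> G\<close> show ?thesis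
    by blast
qed

section \<open>The least majorant of the horizontal gradients\<close>

text \<open>For a fixed \<open>u\<close>, the exceptional null sets of countably many majorants have a null union, off
  which the bound passes to the infimum because \<open>Lip(u) \<ge> 0\<close>. Where the sequence is not bounded
  below, the infimum is an unspecified real number; as majorants are nonnegative almost everywhere,
  this happens only on a null set.\<close>

lemma hgrad_majorants_INF:
  fixes f :: "nat \<Rightarrow> 'a::euclidean_space \<Rightarrow> real" and \<phi> :: "'a \<Rightarrow> 'y::metric_space"
  assumes f: "\<And>i. f i \<in> hgrad_majorants \<Omega> X n \<phi>"
  shows "(\<lambda>x. INF i. f i x) \<in> hgrad_majorants \<Omega> X n \<phi>"
proof -
  have [measurable]: "f i \<in> borel_measurable (lebesgue_on \<Omega>)" for i
    using f[of i] by (simp add: hgrad_majorants_def Linf_iff)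
  have nonneg: "AE x in lebesgue_on \<Omega>. \<forall>i. 0 \<le> f i x"
    using f by (simp add: AE_all_countable hgrad_majorants_def)
  obtain c where "AE x in lebesgue_on \<Omega>. \<bar>f 0 x\<bar> \<le> c"
    using f[of 0] by (auto simp: hgrad_majorants_def Linf_iff)
  with nonneg have "AE x in lebesgue_on \<Omega>. \<bar>INF i. f i x\<bar> \<le> c"
  proof eventually_elim
    case (elim x)
    have "(INF i. f i x) \<le> f 0 x"
      using elim by (intro cINF_lower bdd_belowI2) auto
    moreover have "0 \<le> (INF i. f i x)"
      using elim by (intro cINF_greatest) auto
    ultimately show ?case
      using elim by auto
  qed
  moreover have "AE x in lebesgue_on \<Omega>. 0 \<le> (INF i. f i x)"
    using nonneg by eventually_elim (auto intro: cINF_greatest)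
  moreover have "AE x in lebesgue_on \<Omega>.
      hgrad_norm \<Omega> X n (u \<circ> \<phi>) x \<le> Lip_seminorm u * (INF i. f i x)" if "u \<in> Lip" for u
  proof -
    have "AE x in lebesgue_on \<Omega>. \<forall>i. hgrad_norm \<Omega> X n (u \<circ> \<phi>) x \<le> Lip_seminorm u * f i x"
      using f \<open>u \<in> Lip\<close> by (simp add: AE_all_countable hgrad_majorants_def)
    then show ?thesis
    proof eventually_elim
      case (elim x)
      show ?case
        \<comment> \<open>One cannot divide by \<open>Lip(u) = 0\<close>, but then the bound does not depend on the majorant.\<close>
      proof (cases "Lip_seminorm u = 0")
        case False
        then have pos: "0 < Lip_seminorm u"
          using Lip_seminorm_nonneg[OF \<open>u \<in> Lip\<close>] by simp
        have "hgrad_norm \<Omega> X n (u \<circ> \<phi>) x / Lip_seminorm u \<le> (INF i. f i x)"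
          using elim pos by (intro cINF_greatest) (auto simp: divide_le_eq mult.commute)
        then show ?thesis
          using pos by (simp add: divide_le_eq mult.commute)
      qed (use elim in auto)
    qed
  qed
  ultimately show ?thesis
    by (auto simp: hgrad_majorants_def Linf_iff)
qed

lemma sigma_finite_lebesgue_on:
  fixes \<Omega> :: "'a::euclidean_space set"
  assumes "\<Omega> \<in> sets lebesgue"
  shows "sigma_finite_measure (lebesgue_on \<Omega>)"
proof -
  have "sigma_finite_measure (lebesgue :: 'a measure)"
  proof
    obtain A :: "'a set set" where "countable A" "A \<subseteq> sets lborel" "\<Union>A = space lborel"
      "\<forall>a\<in>A. emeasure lborel a \<noteq> \<infinity>"
      using lborel.sigma_finite_countable by blast
    then show "\<exists>A. countable A \<and> A \<subseteq> sets (lebesgue :: 'a measure) \<and> \<Union>A = space lebesgue \<and>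
        (\<forall>a\<in>A. emeasure lebesgue a \<noteq> \<infinity>)"
      by (intro exI[of _ A]) auto
  qed
  then show ?thesis
    using assms by (intro sigma_finite_measure_restrict_space) auto
qed

text \<open>The set from which \<open>nabla0_norm\<close> chooses is nonempty by \<open>ex_AE_least\<close>; majorants belong to
  \<open>L\<^sub>\<infinity>\<close> and are nonnegative almost everywhere, as is required there.\<close>

lemma nabla0_norm_least:
  fixes \<Omega> :: "'a::euclidean_space set" and \<phi> :: "'a \<Rightarrow> 'y::metric_space"
  assumes "\<Omega> \<in> sets lebesgue" and "hgrad_majorants \<Omega> X n \<phi> \<noteq> {}"
  shows "nabla0_norm \<Omega> X n \<phi> \<in> hgrad_majorants \<Omega> X n \<phi>"
    and "\<And>g. g \<in> hgrad_majorants \<Omega> X n \<phi> \<Longrightarrow> AE x in lebesgue_on \<Omega>. nabla0_norm \<Omega> X n \<phi> x \<le> g x"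
proof -
  interpret sigma_finite_measure "lebesgue_on \<Omega>"
    using assms by (intro sigma_finite_lebesgue_on)
  have "\<exists>g\<in>hgrad_majorants \<Omega> X n \<phi>. \<forall>g'\<in>hgrad_majorants \<Omega> X n \<phi>. AE x in lebesgue_on \<Omega>. g x \<le> g' x"
  proof (rule ex_AE_least)
    show "\<exists>c. AE x in lebesgue_on \<Omega>. g x \<le> c" if "g \<in> hgrad_majorants \<Omega> X n \<phi>" for g
      using that unfolding hgrad_majorants_def Linf_iff by (fastforce elim: eventually_mono)
    show "(\<lambda>x. INF i. f i x) \<in> hgrad_majorants \<Omega> X n \<phi>" if "range f \<subseteq> hgrad_majorants \<Omega> X n \<phi>" for f :: "nat \<Rightarrow> _"
      using that by (intro hgrad_majorants_INF) auto
  qed (use assms in \<open>auto simp: hgrad_majorants_def Linf_iff\<close>)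
  then have "\<exists>g. g \<in> hgrad_majorants \<Omega> X n \<phi> \<and>
      (\<forall>g'\<in>hgrad_majorants \<Omega> X n \<phi>. AE x in lebesgue_on \<Omega>. g x \<le> g' x)"
    by blast
  from someI_ex[OF this]
  show "nabla0_norm \<Omega> X n \<phi> \<in> hgrad_majorants \<Omega> X n \<phi>"
    and "\<And>g. g \<in> hgrad_majorants \<Omega> X n \<phi> \<Longrightarrow> AE x in lebesgue_on \<Omega>. nabla0_norm \<Omega> X n \<phi> x \<le> g x"
    unfolding nabla0_norm_def by blast+
qed

text \<open>The pointwise and the operator formulations of a bound by a constant agree since an essential
  supremum is at most \<open>c\<close> exactly when the function is at most \<open>c\<close> almost everywhere.\<close>

lemma const_in_hgrad_majorants_iff:
  fixes \<phi> :: "'a::euclidean_space \<Rightarrow> 'y::metric_space"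
  assumes "open \<Omega>" and L1inf: "\<And>u. u \<in> Lip \<Longrightarrow> u \<circ> \<phi> \<in> L1inf \<Omega> X n" and "0 \<le> C"
  shows "(\<lambda>x. C) \<in> hgrad_majorants \<Omega> X n \<phi> \<longleftrightarrow> comp_op_bound \<Omega> X n \<phi> C"
proof -
  have "\<bar>hgrad_norm \<Omega> X n u x\<bar> = hgrad_norm \<Omega> X n u x" for u x
    by (simp add: hgrad_norm_def sum_nonneg)
  then have "L1inf_seminorm \<Omega> X n (u \<circ> \<phi>) \<le> ereal (C * Lip_seminorm u) \<longleftrightarrow>
      (AE x in lebesgue_on \<Omega>. hgrad_norm \<Omega> X n (u \<circ> \<phi>) x \<le> Lip_seminorm u * C)" if "u \<in> Lip" for u
    using borel_measurable_hgrad_norm[OF \<open>open \<Omega>\<close> L1inf[OF that]]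
    by (simp add: L1inf_seminorm_def Linf_norm_le_iff mult.commute)
  then show ?thesis
    using \<open>0 \<le> C\<close> by (auto simp: comp_op_bound_def hgrad_majorants_def Linf_iff)
qed

section \<open>The norm of the composition operator\<close>

theorem proposition4p1:
  fixes gmul :: "'a::euclidean_space \<Rightarrow> 'a \<Rightarrow> 'a" and V :: "nat \<Rightarrow> 'a set" and m :: nat
    and e :: "nat \<Rightarrow> 'a" and n :: nat and X :: "nat \<Rightarrow> 'a \<Rightarrow> 'a"
    and \<Omega> :: "'a set" and \<phi> :: "'a \<Rightarrow> 'y::metric_space"
  assumes "carnot_group gmul V m"
    and "orthonormal_basis_of e n (V 1)"
    and "\<And>j. X j = left_inv_field gmul (e j)"
    and "open \<Omega>" and "connected \<Omega>" and "\<Omega> \<noteq> {}"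
    and "induces_bounded_comp_op \<Omega> X n \<phi>"
  shows "\<phi> \<in> L1inf_map \<Omega> X n \<and>
    Linf_norm \<Omega> (nabla0_norm \<Omega> X n \<phi>) = ereal (comp_op_norm \<Omega> X n \<phi>)"
proof
  have L1inf: "u \<circ> \<phi> \<in> L1inf \<Omega> X n" if "u \<in> Lip" for u
    using assms that by (auto simp: induces_bounded_comp_op_def)
  obtain C where C: "comp_op_bound \<Omega> X n \<phi> C"
    using assms by (auto simp: induces_bounded_comp_op_def)
  \<comment> \<open>If all Lipschitz seminorms vanish, even a negative \<open>C\<close> may be a bound, but it is no majorant.\<close>
  have "comp_op_bound \<Omega> X n \<phi> (max 0 C)"
    unfolding comp_op_bound_def
  proof
    fix u :: "'y \<Rightarrow> real" assume "u \<in> Lip"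
    then have "L1inf_seminorm \<Omega> X n (u \<circ> \<phi>) \<le> ereal (C * Lip_seminorm u)"
      using C by (simp add: comp_op_bound_def)
    also have "\<dots> \<le> ereal (max 0 C * Lip_seminorm u)"
      using Lip_seminorm_nonneg[OF \<open>u \<in> Lip\<close>] by (auto intro: mult_right_mono)
    finally show "L1inf_seminorm \<Omega> X n (u \<circ> \<phi>) \<le> ereal (max 0 C * Lip_seminorm u)" .
  qed
  then have nonempty: "hgrad_majorants \<Omega> X n \<phi> \<noteq> {}"
    using const_in_hgrad_majorants_iff[OF \<open>open \<Omega>\<close> L1inf, of "max 0 C"] by auto
  have "\<phi> \<in> borel_measurable (lebesgue_on \<Omega>)"
  proof (rule measurable_if_Lip_comp_measurable)
    show "u \<circ> \<phi> \<in> borel_measurable (lebesgue_on \<Omega>)" if "u \<in> Lip" for u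
      using L1inf[OF that] by (intro borel_measurable_if_L1_loc[OF \<open>open \<Omega>\<close>]) (simp add: L1inf_def)
  qed
  with L1inf nonempty show "\<phi> \<in> L1inf_map \<Omega> X n"
    by (simp add: L1inf_map_def)

  let ?g = "nabla0_norm \<Omega> X n \<phi>"
  have "\<Omega> \<in> sets lebesgue"
    using \<open>open \<Omega>\<close> by simp
  note g = nabla0_norm_least[OF \<open>\<Omega> \<in> sets lebesgue\<close> nonempty]
  have g_Linf: "?g \<in> Linf \<Omega>" and g_meas: "?g \<in> borel_measurable (lebesgue_on \<Omega>)"
    and g_nonneg: "AE x in lebesgue_on \<Omega>. 0 \<le> ?g x"
    and g_major: "\<And>u. u \<in> Lip \<Longrightarrow>
      AE x in lebesgue_on \<Omega>. hgrad_norm \<Omega> X n (u \<circ> \<phi>) x \<le> Lip_seminorm u * ?g x"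
    using g(1) by (auto simp: hgrad_majorants_def Linf_def)
  obtain K where K: "Linf_norm \<Omega> ?g = ereal K" "0 \<le> K"
    using g_Linf Linf_norm_nonneg[OF \<open>open \<Omega>\<close> \<open>\<Omega> \<noteq> {}\<close>, of ?g]
    by (cases "Linf_norm \<Omega> ?g") (auto simp: Linf_def)
  \<comment> \<open>The nonnegative bounds form a half-line starting at \<open>K\<close>, so the least bound exists and equals \<open>K\<close>.\<close>
  have bound_iff: "comp_op_bound \<Omega> X n \<phi> C \<longleftrightarrow> K \<le> C" if "0 \<le> C" for C
  proof -
    have "comp_op_bound \<Omega> X n \<phi> C \<longleftrightarrow> (\<lambda>x. C) \<in> hgrad_majorants \<Omega> X n \<phi>"
      using const_in_hgrad_majorants_iff[OF \<open>open \<Omega>\<close> L1inf \<open>0 \<le> C\<close>] by simp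
    also have "\<dots> \<longleftrightarrow> (AE x in lebesgue_on \<Omega>. ?g x \<le> C)"
    proof
      assume le: "AE x in lebesgue_on \<Omega>. ?g x \<le> C"
      have "AE x in lebesgue_on \<Omega>. hgrad_norm \<Omega> X n (u \<circ> \<phi>) x \<le> Lip_seminorm u * C"
        if "u \<in> Lip" for u
        using g_major[OF that] le
        by eventually_elim (use Lip_seminorm_nonneg[OF that] in \<open>meson mult_left_mono order_trans\<close>)
      then show "(\<lambda>x. C) \<in> hgrad_majorants \<Omega> X n \<phi>"
        using \<open>0 \<le> C\<close> by (auto simp: hgrad_majorants_def Linf_iff)
    qed (rule g(2))
    also have "\<dots> \<longleftrightarrow> (AE x in lebesgue_on \<Omega>. \<bar>?g x\<bar> \<le> C)"
      using g_nonneg by (intro eventually_cong) auto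
    also have "\<dots> \<longleftrightarrow> K \<le> C"
      using Linf_norm_le_iff[OF g_meas, of C] K by simp
    finally show ?thesis .
  qed
  have "comp_op_norm \<Omega> X n \<phi> = K"
    unfolding comp_op_norm_def using K bound_iff by (intro Least_equality) auto
  with K show "Linf_norm \<Omega> ?g = ereal (comp_op_norm \<Omega> X n \<phi>)"
    by simp
qed

end
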